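(* Let $\mathcal S=\{\boldsymbol s_1,\dots,\boldsymbol s_N\}\subset\mathbb R^m$ be a given set of $N$ scenarios and let $\mathcal U_{\mathrm{PCA}}(\mathcal S,m_1)$ be the scenario-induced uncertainty set defined in the context, with principal directions $\boldsymbol d_i$ and extreme projections $\overline\omega_i,\underline\omega_i$, $i\in\{1,\dots,m\}$. Let $m_1$ be a positive integer smaller than $m$, let $\mathcal X$ be the feasible set of decisions $\boldsymbol x$, and define $$Z^*(m):=\min_{\boldsymbol x\in\mathcal X}\ \max_{\boldsymbol u\in\mathcal U_{\mathrm{PCA}}(\mathcal S,m)} f(\boldsymbol x,\boldsymbol u),\qquad Z^*(m_1):=\min_{\boldsymbol x\in\mathcal X}\ \max_{\boldsymbol u\in\mathcal U_{\mathrm{PCA}}(\mathcal S,m_1)} f(\boldsymbol x,\boldsymbol u).$$ Suppose that $f(\boldsymbol x,\boldsymbol u)$ is piecewise linear convex in $\boldsymbol u$, that is, $$f(\boldsymbol x,\boldsymbol u)=\max_{k=1,\dots,K}\left\{y_k^0(\boldsymbol x)+y_k(\boldsymbol x)^{\top}\boldsymbol u\right\},$$ where for every $k\in\{1,\dots,K\}$ both $y_k(\boldsymbol x)=(y_k^1(\boldsymbol x),\dots,y_k^m(\boldsymbol x))^{\top}\in\mathbb R^m$ and $y_k^0(\boldsymbol x)\in\mathbb R$ are affine in $\boldsymbol x$. Then $$0\le Z^*(m)-Z^*(m_1)\le \max_{k=1,\dots,K}\ \sum_{i=m_1+1}^{m}\left|y_k(\hat{\boldsymbol x})^{\top}\overline{\boldsymbol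 d}_i\right|\left(\frac{\overline\omega_i-\underline\omega_i}{2}\right),$$ where $\hat{\boldsymbol x}$ is an optimal solution of the problem defining $Z^*(m_1)$ and $\overline{\boldsymbol d}_i=\boldsymbol d_i/\|\boldsymbol d_i\|$ for $i\in\{m_1+1,\dots,m\}$.
   Context: $\|\cdot\|$ is the Euclidean norm on $\mathbb R^m$. Given scenarios $\boldsymbol s_1,\dots,\boldsymbol s_N\in\mathbb R^m$ ($N\ge 2$), let $\bar{\boldsymbol s}=\frac1N\sum_{j=1}^N\boldsymbol s_j$ be the sample mean, $\boldsymbol s_{j0}=\boldsymbol s_j-\bar{\boldsymbol s}$ the centered scenarios, $\boldsymbol X_0\in\mathbb R^{N\times m}$ the matrix whose $j$-th row is $\boldsymbol s_{j0}^\top$, and $\boldsymbol C=\frac1{N-1}\boldsymbol X_0^\top\boldsymbol X_0$ the sample covariance matrix. Let $\boldsymbol C=\boldsymbol U\boldsymbol\Lambda\boldsymbol U^\top$ be its eigenvalue decomposition with $\boldsymbol U$ orthogonal and the eigenvalues (diagonal entries of $\boldsymbol\Lambda$) in non-increasing order. The principal directions $\boldsymbol d_1,\dots,\boldsymbol d_m$ are the columns of $\boldsymbol U$ in this order. For $i\in\{1,\dots,m\}$ set $$\overline\omega_i=\max_{j=1,\dots,N}\frac{\boldsymbol s_{j0}\cdot\boldsymbol d_i}{\|\boldsymbol d_i\|},\qquad \underline\omega_i=\min_{j=1,\dots,N}\frac{\boldsymbol s_{j0}\cdot\boldsymbol d_i}{\|\boldsymbol d_i\|}.$$ For $1\le m_1\le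 m$ the scenario-induced uncertainty set is $$\mathcal U_{\mathrm{PCA}}(\mathcal S,m_1)=\Big\{\boldsymbol u:\ \boldsymbol u=\bar{\boldsymbol s}+\sum_{i=1}^{m_1}\Big(\alpha_i\frac{\overline\omega_i}{\|\boldsymbol d_i\|}\boldsymbol d_i+(1-\alpha_i)\frac{\underline\omega_i}{\|\boldsymbol d_i\|}\boldsymbol d_i\Big)+\sum_{i=m_1+1}^{m}\frac{\overline\omega_i+\underline\omega_i}{2\|\boldsymbol d_i\|}\boldsymbol d_i,\ 0\le\alpha_i\le1\ \ \forall i\in\{1,\dots,m_1\}\Big\}.$$ The same scenarios, directions and values $\overline\omega_i,\underline\omega_i$ are used for $m$ and $m_1$. The minima over $\mathcal X$ are understood to be attained, as the notation $\min$ indicates. *)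

theory Defs
  imports "HOL-Analysis.Analysis"
begin

section \<open>Sample covariance and principal directions\<close>

text \<open>
  The finite type \<open>'N\<close> indexes the \<open>N = CARD('N)\<close> scenarios, and \<open>m = CARD('m)\<close>.
  Repetitions among the scenarios are allowed.
\<close>

definition sample_mean :: "('N::finite \<Rightarrow> real^'m) \<Rightarrow> real^'m" where
  "sample_mean s = (1 / real CARD('N)) *\<^sub>R (\<Sum>j\<in>UNIV. s j)"

definition centered :: "('N::finite \<Rightarrow> real^'m) \<Rightarrow> 'N \<Rightarrow> real^'m" where
  "centered s j = s j - sample_mean s"

definition centered_matrix :: "('N::finite \<Rightarrow> real^'m) \<Rightarrow> real^'m^'N" where
  "centered_matrix s = (\<chi> j. centered s j)"

definition sample_covariance :: "('N::finite \<Rightarrow> real^'m) \<Rightarrow> real^'m^'m" where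
  "sample_covariance s =
     (1 / (real CARD('N) - 1)) *\<^sub>R (transpose (centered_matrix s) ** centered_matrix s)"

text \<open>
  The index type \<open>'m\<close> carries no order, so the bijection \<open>e\<close> from \<open>{1..m}\<close> lists the columns
  of \<open>U\<close> (and the diagonal entries of \<open>\<Lambda>\<close>) by non-increasing eigenvalue.  Values of \<open>d\<close>
  outside \<open>{1..m}\<close> play no role.
\<close>

definition principal_directions :: "('N::finite \<Rightarrow> real^'m) \<Rightarrow> (nat \<Rightarrow> real^'m) \<Rightarrow> bool" where
  "principal_directions s d \<longleftrightarrow>
     (\<exists>(U :: real^'m^'m) (\<Lambda> :: real^'m^'m) (e :: nat \<Rightarrow> 'm).
        orthogonal_matrix U \<and>
        (\<forall>a b. a \<noteq> b \<longrightarrow> \<Lambda> $ a $ b = 0) \<and>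
        sample_covariance s = U ** \<Lambda> ** transpose U \<and>
        bij_betw e {1..CARD('m)} UNIV \<and>
        (\<forall>i\<in>{1..CARD('m)}. \<forall>j\<in>{1..CARD('m)}. i \<le> j \<longrightarrow> \<Lambda> $ e j $ e j \<le> \<Lambda> $ e i $ e i) \<and>
        (\<forall>i\<in>{1..CARD('m)}. d i = column (e i) U))"

section \<open>The scenario-induced uncertainty set\<close>

definition omega_upper :: "('N::finite \<Rightarrow> real^'m) \<Rightarrow> (nat \<Rightarrow> real^'m) \<Rightarrow> nat \<Rightarrow> real" where
  "omega_upper s d i = (MAX j. (centered s j \<bullet> d i) / norm (d i))"

definition omega_lower :: "('N::finite \<Rightarrow> real^'m) \<Rightarrow> (nat \<Rightarrow> real^'m) \<Rightarrow> nat \<Rightarrow> real" where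
  "omega_lower s d i = (MIN j. (centered s j \<bullet> d i) / norm (d i))"

definition U_PCA ::
  "('N::finite \<Rightarrow> real^'m) \<Rightarrow> (nat \<Rightarrow> real^'m) \<Rightarrow> nat \<Rightarrow> (real^'m) set" where
  "U_PCA s d m1 =
     {u. \<exists>\<alpha> :: nat \<Rightarrow> real. (\<forall>i\<in>{1..m1}. 0 \<le> \<alpha> i \<and> \<alpha> i \<le> 1) \<and>
        u = sample_mean s
          + (\<Sum>i\<in>{1..m1}. (\<alpha> i * (omega_upper s d i / norm (d i))) *\<^sub>R d i
                       + ((1 - \<alpha> i) * (omega_lower s d i / norm (d i))) *\<^sub>R d i)
          + (\<Sum>i\<in>{m1+1..CARD('m)}.
                ((omega_upper s d i + omega_lower s d i) / (2 * norm (d i))) *\<^sub>R d i)}"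

section \<open>The min-max problem\<close>

text \<open>
  The maximum and the minimum are literally the greatest and the least element of the set of
  values, not merely its supremum and infimum.
\<close>

definition worst_case :: "('x \<Rightarrow> 'u \<Rightarrow> real) \<Rightarrow> 'u set \<Rightarrow> 'x \<Rightarrow> real" where
  "worst_case f \<U> x = (GREATEST v. v \<in> f x ` \<U>)"

definition minmax_value :: "('x \<Rightarrow> 'u \<Rightarrow> real) \<Rightarrow> 'x set \<Rightarrow> 'u set \<Rightarrow> real" where
  "minmax_value f X \<U> = (LEAST v. v \<in> worst_case f \<U> ` X)"

definition minmax_solution :: "('x \<Rightarrow> 'u \<Rightarrow> real) \<Rightarrow> 'x set \<Rightarrow> 'u set \<Rightarrow> 'x \<Rightarrow> bool" where
  "minmax_solution f X \<U> x \<longleftrightarrow> is_arg_min (worst_case f \<U>) (\<lambda>x. x \<in> X) x"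

definition affine_map :: "('a::real_vector \<Rightarrow> 'b::real_vector) \<Rightarrow> bool" where
  "affine_map g \<longleftrightarrow> (\<exists>L b. linear L \<and> g = (\<lambda>x. L x + b))"

end

theory Submission
  imports Defs
begin

text \<open>
  The uncertainty set with \<open>l\<close> principal directions is a zonotope: its centre does not depend
  on \<open>l\<close>, and its generators are the first \<open>l\<close> unit directions scaled by the half-widths
  \<open>(omega_upper - omega_lower) / 2\<close>.  This is what replacing the discarded coordinates by their
  midpoints achieves (\<open>U_PCA_eq_zonotope\<close>).

  A linear functional \<open>y\<close> attains on a zonotope the maximum value
  \<open>y \<bullet> c + (\<Sum>i. \<bar>y \<bullet> g i\<bar>)\<close>, by moving along each generator to the end that \<open>y\<close>
  prefers.  A maximum of finitely many affine functions commutes with the maximum over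
  \<open>u\<close>, so the worst case of \<open>f\<close> at \<open>x\<close> has a closed form in which \<open>l\<close> enters only through
  the number of nonnegative summands (\<open>worst_case_zonotope\<close>).  Passing from \<open>m1\<close> to \<open>m\<close>
  directions therefore never lowers the worst case, and raises it at a fixed \<open>x\<close> by at most the
  largest sum of the additional terms.

  The lower bound on the gap is the first fact at an optimal solution of the full problem;
  the upper bound is the second fact at \<open>xhat\<close>, which is feasible for the full problem.
\<close>

section \<open>Support functions of zonotopes\<close>

definition zonotope :: "'a::real_inner \<Rightarrow> (nat \<Rightarrow> 'a) \<Rightarrow> nat set \<Rightarrow> 'a set" where
  "zonotope c g I = {c + (\<Sum>i\<in>I. \<beta> i *\<^sub>R g i) |\<beta>. \<forall>i\<in>I. \<bar>\<beta> i\<bar> \<le> 1}"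

lemma inner_zonotope_le:
  assumes "u \<in> zonotope c g I"
  shows "y \<bullet> u \<le> y \<bullet> c + (\<Sum>i\<in>I. \<bar>y \<bullet> g i\<bar>)"
proof -
  obtain \<beta> where u: "u = c + (\<Sum>i\<in>I. \<beta> i *\<^sub>R g i)" and \<beta>: "\<forall>i\<in>I. \<bar>\<beta> i\<bar> \<le> 1"
    using assms unfolding zonotope_def by blast
  have "\<beta> i * (y \<bullet> g i) \<le> \<bar>y \<bullet> g i\<bar>" if "i \<in> I" for i
  proof -
    have "\<beta> i * (y \<bullet> g i) \<le> \<bar>\<beta> i\<bar> * \<bar>y \<bullet> g i\<bar>"
      by (metis abs_ge_self abs_mult)
    also have "\<dots> \<le> \<bar>y \<bullet> g i\<bar>"
      using \<beta> that by (simp add: mult_left_le_one_le)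
    finally show ?thesis .
  qed
  then show ?thesis
    by (simp add: u inner_add_right inner_sum_right sum_mono)
qed

lemma inner_zonotope_attained:
  obtains u where "u \<in> zonotope c g I" "y \<bullet> u = y \<bullet> c + (\<Sum>i\<in>I. \<bar>y \<bullet> g i\<bar>)"
proof
  let ?u = "c + (\<Sum>i\<in>I. sgn (y \<bullet> g i) *\<^sub>R g i)"
  show "?u \<in> zonotope c g I"
    unfolding zonotope_def by (auto simp: abs_sgn_eq intro!: exI[of _ "\<lambda>i. sgn (y \<bullet> g i)"])
  show "y \<bullet> ?u = y \<bullet> c + (\<Sum>i\<in>I. \<bar>y \<bullet> g i\<bar>)"
    by (simp add: inner_add_right inner_sum_right abs_sgn mult.commute)
qed

text \<open>
  The outer maximum over the pieces is attained at one piece, and the maximiser of that single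
  piece over the zonotope is then a maximiser of the whole function, so the greatest element in
  the definition of the worst case exists.
\<close>

lemma worst_case_zonotope:
  assumes "finite A" "A \<noteq> {}"
    and f: "\<And>u. f x u = (MAX k\<in>A. b k + y k \<bullet> u)"
  shows "worst_case f (zonotope c g I) x
           = (MAX k\<in>A. b k + y k \<bullet> c + (\<Sum>i\<in>I. \<bar>y k \<bullet> g i\<bar>))"
    (is "_ = ?M")
proof -
  have upper: "f x u \<le> ?M" if u: "u \<in> zonotope c g I" for u
  proof -
    have "b k + y k \<bullet> u \<le> ?M" if "k \<in> A" for k
    proof -
      have "b k + y k \<bullet> u \<le> b k + y k \<bullet> c + (\<Sum>i\<in>I. \<bar>y k \<bullet> g i\<bar>)"
        using inner_zonotope_le[OF u, of "y k"] by simp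
      also have "\<dots> \<le> ?M"
        using assms that by (intro Max_ge) auto
      finally show ?thesis .
    qed
    then show ?thesis
      using assms by (auto simp: f)
  qed
  have "?M \<in> (\<lambda>k. b k + y k \<bullet> c + (\<Sum>i\<in>I. \<bar>y k \<bullet> g i\<bar>)) ` A"
    using assms by (intro Max_in) auto
  then obtain k where k: "k \<in> A" and M: "?M = b k + y k \<bullet> c + (\<Sum>i\<in>I. \<bar>y k \<bullet> g i\<bar>)"
    by blast
  obtain u where u: "u \<in> zonotope c g I" "y k \<bullet> u = y k \<bullet> c + (\<Sum>i\<in>I. \<bar>y k \<bullet> g i\<bar>)"
    by (rule inner_zonotope_attained)
  have "b k + y k \<bullet> u \<le> f x u"
    unfolding f using assms k by (intro Max_ge) auto
  then have "f x u = ?M"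
    using upper[OF u(1)] u(2) M by linarith
  then show ?thesis
    unfolding worst_case_def using u(1) upper
    by (intro Greatest_equality) (auto intro: rev_image_eqI)
qed

section \<open>The PCA uncertainty set as a zonotope\<close>

definition half_width :: "('N::finite \<Rightarrow> real^'m) \<Rightarrow> (nat \<Rightarrow> real^'m) \<Rightarrow> nat \<Rightarrow> real" where
  "half_width s d i = (omega_upper s d i - omega_lower s d i) / 2"

definition pca_center :: "('N::finite \<Rightarrow> real^'m) \<Rightarrow> (nat \<Rightarrow> real^'m) \<Rightarrow> real^'m" where
  "pca_center s d = sample_mean s
     + (\<Sum>i\<in>{1..CARD('m)}.
          ((omega_upper s d i + omega_lower s d i) / (2 * norm (d i))) *\<^sub>R d i)"

definition pca_generator :: "('N::finite \<Rightarrow> real^'m) \<Rightarrow> (nat \<Rightarrow> real^'m) \<Rightarrow> nat \<Rightarrow> real^'m" where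
  "pca_generator s d i = half_width s d i *\<^sub>R ((1 / norm (d i)) *\<^sub>R d i)"

lemma half_width_nonneg: "0 \<le> half_width s d i"
proof -
  have "omega_lower s d i \<le> centered s undefined \<bullet> d i / norm (d i)"
    unfolding omega_lower_def by (intro Min_le) auto
  also have "\<dots> \<le> omega_upper s d i"
    unfolding omega_upper_def by (intro Max_ge) auto
  finally show ?thesis
    by (simp add: half_width_def)
qed

text \<open>
  Since the half-width is nonnegative it leaves the absolute value, which turns the terms of the
  support function into the summands of the error bound.
\<close>

lemma abs_inner_pca_generator:
  "\<bar>y \<bullet> pca_generator s d i\<bar> = \<bar>y \<bullet> ((1 / norm (d i)) *\<^sub>R d i)\<bar> * half_width s d i"
  by (simp add: pca_generator_def abs_mult half_width_nonneg)

text \<open>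
  The barycentric coordinate \<open>\<alpha>\<close> on the segment between the two extreme projections
  corresponds to the signed offset \<open>\<beta> = 2 * \<alpha> - 1\<close> from its midpoint.
\<close>

lemma U_PCA_eq_zonotope:
  fixes s :: "'N::finite \<Rightarrow> real^'m"
  assumes "l \<le> CARD('m)"
  shows "U_PCA s d l = zonotope (pca_center s d) (pca_generator s d) {1..l}"
proof -
  let ?mid = "\<lambda>i. ((omega_upper s d i + omega_lower s d i) / (2 * norm (d i))) *\<^sub>R d i"
  let ?seg = "\<lambda>a i. (a i * (omega_upper s d i / norm (d i))) *\<^sub>R d i
                 + ((1 - a i) * (omega_lower s d i / norm (d i))) *\<^sub>R d i"
  have split_center: "pca_center s d = sample_mean s + (\<Sum>i\<in>{1..l}. ?mid i)
      + (\<Sum>i\<in>{l+1..CARD('m)}. ?mid i)"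
    using sum.ub_add_nat[of 1 l ?mid "CARD('m) - l"] assms by (simp add: pca_center_def)
  have seg: "?seg a i = ?mid i + (2 * a i - 1) *\<^sub>R pca_generator s d i" for a i
  \<comment> \<open>In the degenerate case \<open>d i = 0\<close> both sides are multiples of the zero vector.\<close>
  proof (cases "d i = 0")
    case False
    then show ?thesis
      unfolding pca_generator_def half_width_def scaleR_scaleR scaleR_add_left[symmetric]
      by (intro arg_cong[where f = "\<lambda>r. r *\<^sub>R d i"]) (simp add: field_simps)
  qed (simp add: pca_generator_def)
  have point: "sample_mean s + (\<Sum>i\<in>{1..l}. ?seg a i) + (\<Sum>i\<in>{l+1..CARD('m)}. ?mid i)
      = pca_center s d + (\<Sum>i\<in>{1..l}. (2 * a i - 1) *\<^sub>R pca_generator s d i)" for a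
    unfolding split_center seg sum.distrib by (simp add: algebra_simps)
  show ?thesis
  proof (intro equalityI subsetI)
    fix u assume "u \<in> U_PCA s d l"
    then obtain a where a: "\<forall>i\<in>{1..l}. 0 \<le> a i \<and> a i \<le> 1"
      and u: "u = pca_center s d + (\<Sum>i\<in>{1..l}. (2 * a i - 1) *\<^sub>R pca_generator s d i)"
      unfolding U_PCA_def mem_Collect_eq point by blast
    have "\<forall>i\<in>{1..l}. \<bar>2 * a i - 1\<bar> \<le> 1"
      using a by (auto simp: abs_le_iff)
    with u show "u \<in> zonotope (pca_center s d) (pca_generator s d) {1..l}"
      unfolding zonotope_def mem_Collect_eq by (intro exI[of _ "\<lambda>i. 2 * a i - 1"]) simp
  next
    fix u assume "u \<in> zonotope (pca_center s d) (pca_generator s d) {1..l}"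
    then obtain \<beta> where \<beta>: "\<forall>i\<in>{1..l}. \<bar>\<beta> i\<bar> \<le> 1"
      and u: "u = pca_center s d + (\<Sum>i\<in>{1..l}. \<beta> i *\<^sub>R pca_generator s d i)"
      unfolding zonotope_def by blast
    show "u \<in> U_PCA s d l"
      unfolding U_PCA_def mem_Collect_eq point
    proof (intro exI[of _ "\<lambda>i. (1 + \<beta> i) / 2"] conjI ballI)
      fix i assume "i \<in> {1..l}"
      then have "\<bar>\<beta> i\<bar> \<le> 1" using \<beta> by blast
      then show "0 \<le> (1 + \<beta> i) / 2" "(1 + \<beta> i) / 2 \<le> 1" by (simp_all add: abs_le_iff)
    next
      have "2 * ((1 + \<beta> i) / 2) - 1 = \<beta> i" for i
        by (simp add: field_simps)
      then show "u = pca_center s d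
          + (\<Sum>i\<in>{1..l}. (2 * ((1 + \<beta> i) / 2) - 1) *\<^sub>R pca_generator s d i)"
        by (simp only: u)
    qed
  qed
qed

section \<open>Comparison of the optimal values\<close>

lemma minmax_solution_value:
  assumes "minmax_solution f X \<U> x"
  shows "minmax_value f X \<U> = worst_case f \<U> x"
    and "x \<in> X"
    and "\<And>x'. x' \<in> X \<Longrightarrow> worst_case f \<U> x \<le> worst_case f \<U> x'"
proof -
  show "x \<in> X" and min: "\<And>x'. x' \<in> X \<Longrightarrow> worst_case f \<U> x \<le> worst_case f \<U> x'"
    using assms unfolding minmax_solution_def is_arg_min_linorder by auto
  then show "minmax_value f X \<U> = worst_case f \<U> x"
    unfolding minmax_value_def by (intro Least_equality) auto
qed

lemma Max_image_le_add:
  fixes p q r :: "'a \<Rightarrow> real"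
  assumes "finite A" "A \<noteq> {}" "\<And>k. k \<in> A \<Longrightarrow> p k \<le> q k + r k"
  shows "(MAX k\<in>A. p k) \<le> (MAX k\<in>A. q k) + (MAX k\<in>A. r k)"
proof -
  have "p k \<le> (MAX k\<in>A. q k) + (MAX k\<in>A. r k)" if "k \<in> A" for k
  proof -
    have "q k \<le> (MAX k\<in>A. q k)" "r k \<le> (MAX k\<in>A. r k)"
      using assms(1) that by (auto intro: Max_ge)
    then show ?thesis
      using assms(3)[OF that] by linarith
  qed
  then show ?thesis
    using assms by auto
qed

theorem theorem1:
  fixes s :: "'N::finite \<Rightarrow> real^'m"
    and d :: "nat \<Rightarrow> real^'m"
    and m1 K :: nat
    and X :: "(real^'n) set"
    and f :: "real^'n \<Rightarrow> real^'m \<Rightarrow> real"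
    and y0 :: "nat \<Rightarrow> real^'n \<Rightarrow> real"
    and y :: "nat \<Rightarrow> real^'n \<Rightarrow> real^'m"
    and xhat :: "real^'n"
  assumes "CARD('N) \<ge> 2"
    and "principal_directions s d"
    and "1 \<le> m1" and "m1 < CARD('m)"
    and "K \<ge> 1"
    and "\<And>k. k \<in> {1..K} \<Longrightarrow> affine_map (y0 k)"
    and "\<And>k. k \<in> {1..K} \<Longrightarrow> affine_map (y k)"
    and "\<And>x u. f x u = (MAX k\<in>{1..K}. y0 k x + y k x \<bullet> u)"
    and "\<exists>x. minmax_solution f X (U_PCA s d CARD('m)) x"
    and "minmax_solution f X (U_PCA s d m1) xhat"
  defines "Z \<equiv> \<lambda>l. minmax_value f X (U_PCA s d l)"
  shows "0 \<le> Z CARD('m) - Z m1 \<and>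
         Z CARD('m) - Z m1
           \<le> (MAX k\<in>{1..K}. \<Sum>i\<in>{m1+1..CARD('m)}.
                \<bar>y k xhat \<bullet> ((1 / norm (d i)) *\<^sub>R d i)\<bar>
                  * ((omega_upper s d i - omega_lower s d i) / 2))"
proof -
  let ?m = "CARD('m)"
  let ?W = "\<lambda>l. worst_case f (U_PCA s d l)"
  let ?t = "\<lambda>x k i. \<bar>y k x \<bullet> ((1 / norm (d i)) *\<^sub>R d i)\<bar> * half_width s d i"
  let ?g = "\<lambda>l x k. y0 k x + y k x \<bullet> pca_center s d + (\<Sum>i\<in>{1..l}. ?t x k i)"
  have K: "finite {1..K}" "{1..K} \<noteq> {}"
    using assms(5) by auto
  have W: "?W l x = (MAX k\<in>{1..K}. ?g l x k)" if "l \<le> ?m" for l x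
    using worst_case_zonotope[where f = f and x = x and b = "\<lambda>k. y0 k x"
        and y = "\<lambda>k. y k x", OF K assms(8)] that
    by (simp only: U_PCA_eq_zonotope abs_inner_pca_generator)
  have split_sum: "?g ?m x k = ?g m1 x k + (\<Sum>i\<in>{m1+1..?m}. ?t x k i)" for x k
    using sum.ub_add_nat[of 1 m1 "?t x k" "?m - m1"] assms(4) by simp
  have extra_nonneg: "0 \<le> (\<Sum>i\<in>{m1+1..?m}. ?t x k i)" for x k
    by (intro sum_nonneg mult_nonneg_nonneg half_width_nonneg) simp
  have mono: "?W m1 x \<le> ?W ?m x" for x
  proof -
    have "?g m1 x k \<le> ?g ?m x k" for k
      using extra_nonneg[where x = x and k = k] unfolding split_sum by linarith
    then have "(MAX k\<in>{1..K}. ?g m1 x k) \<le> (MAX k\<in>{1..K}. ?g ?m x k)"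
      using Max_image_le_add[OF K, of "?g m1 x" "?g ?m x" "\<lambda>_. 0"] K by simp
    then show ?thesis
      using assms(4) by (simp only: W less_imp_le order_refl)
  qed
  have gap: "?W ?m x \<le> ?W m1 x + (MAX k\<in>{1..K}. \<Sum>i\<in>{m1+1..?m}. ?t x k i)" for x
  proof -
    have "(MAX k\<in>{1..K}. ?g ?m x k)
        \<le> (MAX k\<in>{1..K}. ?g m1 x k) + (MAX k\<in>{1..K}. \<Sum>i\<in>{m1+1..?m}. ?t x k i)"
      by (intro Max_image_le_add[OF K]) (simp only: split_sum order_refl)
    then show ?thesis
      using assms(4) by (simp only: W less_imp_le order_refl)
  qed
  obtain xm where xm: "minmax_solution f X (U_PCA s d ?m) xm"
    using assms(9) by blast
  note full = minmax_solution_value[OF xm]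
  note reduced = minmax_solution_value[OF assms(10)]
  have "?W m1 xhat \<le> ?W ?m xm"
    using reduced(3)[OF full(2)] mono[of xm] by linarith
  moreover have "?W ?m xm \<le> ?W m1 xhat + (MAX k\<in>{1..K}. \<Sum>i\<in>{m1+1..?m}. ?t xhat k i)"
    using full(3)[OF reduced(2)] gap[of xhat] by linarith
  ultimately show ?thesis
    unfolding Z_def full(1) reduced(1) half_width_def by linarith
qed

end
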